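(* For any rational $\overline{\mathbb{E}}$-inner function $x=(x_1,x_2,x_3)$, $\deg(x)$ is the degree $\deg(x_3)$ (in the usual sense) of the finite Blaschke product $x_3$.
   Context: $\mathbb{D}$ is the open unit disc and $\mathbb{T}$ the unit circle in $\mathbb{C}$. The open tetrablock is $\mathbb{E}=\{(x_1,x_2,x_3)\in\mathbb{C}^3: 1-x_1z-x_2w+x_3zw\neq 0 \text{ whenever } |z|\le 1,|w|\le 1\}$, with closure $\overline{\mathbb{E}}$. Its distinguished boundary is $b\overline{\mathbb{E}}=\{x\in\mathbb{C}^3: x_1=\overline{x_2}x_3,\ |x_3|=1,\ |x_2|\le 1\}$. A rational $\overline{\mathbb{E}}$-inner function is a rational analytic map $x=(x_1,x_2,x_3):\mathbb{D}\to\overline{\mathbb{E}}$ (automatically continuous on $\overline{\mathbb{D}}$) that maps $\mathbb{T}$ into $b\overline{\mathbb{E}}$; its third component $x_3$ is then a rational inner function, i.e. a finite Blaschke product. Definition of $\deg(x)$: $b\overline{\mathbb{E}}$ is homotopy equivalent to $\mathbb{T}$ (via $(x_1,x_2,x_3)\mapsto x_3$ and $z\mapsto(0,0,z)$), so $\pi_1(b\overline{\mathbb{E}})=\mathbb{Z}$. The degree $\deg(x)$ is $x_*(1)$, where $x_*:\mathbb{Z}=\pi_1(\mathbb{T})\to\pi_1(b\overline{\mathbb{E}})=\mathbb{Z}$ is the homomorphism of fundamental groups induced by $x$ regarded as a continuous map from $\mathbb{T}$ to $b\overline{\mathbb{E}}$; by convention $\deg(x)$ is a non-negative integer. *)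

theory Defs
  imports "HOL-Complex_Analysis.Complex_Analysis" "HOL-Algebra.Group"
begin

section \<open>The tetrablock and rational inner functions\<close>

definition tetrablock :: "(complex \<times> complex \<times> complex) set" where
  "tetrablock = {(x1, x2, x3). \<forall>z w. cmod z \<le> 1 \<longrightarrow> cmod w \<le> 1 \<longrightarrow>
                   1 - x1 * z - x2 * w + x3 * z * w \<noteq> 0}"

definition tetrablock_dist_boundary :: "(complex \<times> complex \<times> complex) set" where
  "tetrablock_dist_boundary = {(x1, x2, x3). x1 = cnj x2 * x3 \<and> cmod x3 = 1 \<and> cmod x2 \<le> 1}"

abbreviation comp1 :: "complex \<times> complex \<times> complex \<Rightarrow> complex" where
  "comp1 x \<equiv> fst x"
abbreviation comp2 :: "complex \<times> complex \<times> complex \<Rightarrow> complex" where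
  "comp2 x \<equiv> fst (snd x)"
abbreviation comp3 :: "complex \<times> complex \<times> complex \<Rightarrow> complex" where
  "comp3 x \<equiv> snd (snd x)"

text \<open>
  \<open>f\<close> is given on the closed disc by a rational function in lowest terms that has no pole in the
  open disc. Poles on the circle are not excluded here. If \<open>f\<close> is bounded on the open disc, as for
  the components of a map into the closed tetrablock, then lowest terms leave no zero of \<open>q\<close> on the
  circle, and the values of \<open>f\<close> there are those of its continuous extension.
\<close>
definition rational_analytic_on_disc :: "(complex \<Rightarrow> complex) \<Rightarrow> bool" where
  "rational_analytic_on_disc f \<longleftrightarrow>
     (\<exists>p q. coprime p q \<and> (\<forall>z\<in>ball 0 1. poly q z \<noteq> 0) \<and>
            (\<forall>z\<in>cball 0 1. f z = poly p z / poly q z))"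

definition rational_tetra_inner :: "(complex \<Rightarrow> complex \<times> complex \<times> complex) \<Rightarrow> bool" where
  "rational_tetra_inner x \<longleftrightarrow>
     rational_analytic_on_disc (\<lambda>z. comp1 (x z)) \<and>
     rational_analytic_on_disc (\<lambda>z. comp2 (x z)) \<and>
     rational_analytic_on_disc (\<lambda>z. comp3 (x z)) \<and>
     (\<forall>z\<in>ball 0 1. x z \<in> closure tetrablock) \<and>
     (\<forall>z\<in>sphere 0 1. x z \<in> tetrablock_dist_boundary)"


section \<open>Fundamental groups\<close>

definition loops_at :: "'a::topological_space set \<Rightarrow> 'a \<Rightarrow> (real \<Rightarrow> 'a) set" where
  "loops_at S a = {g. path g \<and> path_image g \<subseteq> S \<and> pathstart g = a \<and> pathfinish g = a}"

definition homotopy_rel :: "'a::topological_space set \<Rightarrow> 'a \<Rightarrow> ((real \<Rightarrow> 'a) \<times> (real \<Rightarrow> 'a)) set" where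
  "homotopy_rel S a = {(g, h). g \<in> loops_at S a \<and> h \<in> loops_at S a \<and> homotopic_paths S g h}"

abbreviation loop_class :: "'a::topological_space set \<Rightarrow> 'a \<Rightarrow> (real \<Rightarrow> 'a) \<Rightarrow> (real \<Rightarrow> 'a) set" where
  "loop_class S a g \<equiv> homotopy_rel S a `` {g}"

definition fundamental_group :: "'a::topological_space set \<Rightarrow> 'a \<Rightarrow> (real \<Rightarrow> 'a) set monoid" where
  "fundamental_group S a =
     \<lparr>carrier = loops_at S a // homotopy_rel S a,
      monoid.mult = (\<lambda>A B. \<Union>g\<in>A. \<Union>h\<in>B. loop_class S a (g +++ h)),
      one = loop_class S a (\<lambda>_. a)\<rparr>"

text \<open>The map induced by \<open>f\<close>, from the fundamental group of its source at \<open>a\<close> to that of \<open>T\<close> at \<open>f a\<close>.\<close>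
definition induced_map ::
  "'b::topological_space set \<Rightarrow> ('a::topological_space \<Rightarrow> 'b) \<Rightarrow> 'a \<Rightarrow> (real \<Rightarrow> 'a) set \<Rightarrow> (real \<Rightarrow> 'b) set" where
  "induced_map T f a A = (\<Union>g\<in>A. loop_class T (f a) (f \<circ> g))"

lemma equiv_homotopy_rel: "equiv (loops_at S a) (homotopy_rel S a)"
  by (rule equivI)
     (auto simp: homotopy_rel_def refl_on_def sym_def trans_def loops_at_def
           intro: homotopic_paths_sym homotopic_paths_trans)

lemma loops_at_join: "g \<in> loops_at S a \<Longrightarrow> h \<in> loops_at S a \<Longrightarrow> g +++ h \<in> loops_at S a"
  by (auto simp: loops_at_def path_image_join)

lemma loop_class_eq_iff:
  "g \<in> loops_at S a \<Longrightarrow> h \<in> loops_at S a \<Longrightarrow>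
     loop_class S a g = loop_class S a h \<longleftrightarrow> homotopic_paths S g h"
  using eq_equiv_class_iff[OF equiv_homotopy_rel, of g S a h] by (auto simp: homotopy_rel_def)

lemma fundamental_group_carrier: "carrier (fundamental_group S a) = loop_class S a ` loops_at S a"
  by (auto simp: fundamental_group_def quotient_def)

lemma fundamental_group_mult:
  assumes "g \<in> loops_at S a" "h \<in> loops_at S a"
  shows "loop_class S a g \<otimes>\<^bsub>fundamental_group S a\<^esub> loop_class S a h = loop_class S a (g +++ h)"
proof -
  have "congruent2 (homotopy_rel S a) (homotopy_rel S a) (\<lambda>g h. loop_class S a (g +++ h))"
  proof (rule congruent2I')
    fix g g' h h'
    assume "(g, g') \<in> homotopy_rel S a" "(h, h') \<in> homotopy_rel S a"
    then show "loop_class S a (g +++ h) = loop_class S a (g' +++ h')"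
      by (subst loop_class_eq_iff)
         (auto simp: homotopy_rel_def intro!: loops_at_join homotopic_paths_join, auto simp: loops_at_def)
  qed
  from UN_equiv_class2[OF equiv_homotopy_rel equiv_homotopy_rel this assms]
  show ?thesis by (simp add: fundamental_group_def)
qed

lemma const_in_loops_at: "a \<in> S \<Longrightarrow> (\<lambda>_. a) \<in> loops_at S a"
  by (auto simp: loops_at_def path_def path_image_def pathstart_def pathfinish_def)

lemma group_fundamental_group:
  fixes S :: "'a::real_normed_vector set"
  assumes "a \<in> S"
  shows "group (fundamental_group S a)"
proof (rule groupI)
  let ?G = "fundamental_group S a"
  have one: "\<one>\<^bsub>?G\<^esub> = loop_class S a (\<lambda>_. a)"
    by (simp add: fundamental_group_def)
  note [simp] = fundamental_group_mult loops_at_join const_in_loops_at[OF assms]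
  show "\<one>\<^bsub>?G\<^esub> \<in> carrier ?G"
    by (simp add: one fundamental_group_carrier)
  show "x \<otimes>\<^bsub>?G\<^esub> y \<in> carrier ?G" if "x \<in> carrier ?G" "y \<in> carrier ?G" for x y
    using that by (auto simp: fundamental_group_carrier)
  show "x \<otimes>\<^bsub>?G\<^esub> y \<otimes>\<^bsub>?G\<^esub> z = x \<otimes>\<^bsub>?G\<^esub> (y \<otimes>\<^bsub>?G\<^esub> z)"
    if "x \<in> carrier ?G" "y \<in> carrier ?G" "z \<in> carrier ?G" for x y z
  proof -
    obtain g h k where ghk: "g \<in> loops_at S a" "h \<in> loops_at S a" "k \<in> loops_at S a"
      and "x = loop_class S a g" "y = loop_class S a h" "z = loop_class S a k"
      using \<open>x \<in> carrier ?G\<close> \<open>y \<in> carrier ?G\<close> \<open>z \<in> carrier ?G\<close> by (auto simp: fundamental_group_carrier)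
    moreover have "homotopic_paths S (g +++ (h +++ k)) ((g +++ h) +++ k)"
      using ghk by (intro homotopic_paths_assoc) (auto simp: loops_at_def)
    ultimately show ?thesis
      by (simp add: loop_class_eq_iff homotopic_paths_sym)
  qed
  have linepath_a: "linepath a a = (\<lambda>_. a)"
    by (auto simp: linepath_def algebra_simps)
  show "\<one>\<^bsub>?G\<^esub> \<otimes>\<^bsub>?G\<^esub> x = x" if x: "x \<in> carrier ?G" for x
  proof -
    obtain g where g: "g \<in> loops_at S a" "x = loop_class S a g"
      using x by (auto simp: fundamental_group_carrier)
    moreover have "homotopic_paths S ((\<lambda>_. a) +++ g) g"
      using homotopic_paths_lid[of g S] g(1) by (simp add: loops_at_def linepath_a)
    ultimately show ?thesis by (simp add: one loop_class_eq_iff)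
  qed
  show "\<exists>y\<in>carrier ?G. y \<otimes>\<^bsub>?G\<^esub> x = \<one>\<^bsub>?G\<^esub>" if x: "x \<in> carrier ?G" for x
  proof -
    obtain g where g: "g \<in> loops_at S a" "x = loop_class S a g"
      using x by (auto simp: fundamental_group_carrier)
    have r: "reversepath g \<in> loops_at S a"
      using g(1) by (auto simp: loops_at_def)
    have "homotopic_paths S (reversepath g +++ g) (\<lambda>_. a)"
      using homotopic_paths_linv[of g S] g(1) by (simp add: loops_at_def linepath_a)
    then have "loop_class S a (reversepath g) \<otimes>\<^bsub>?G\<^esub> x = \<one>\<^bsub>?G\<^esub>"
      using g r by (simp add: one loop_class_eq_iff)
    with r show ?thesis by (auto simp: fundamental_group_carrier)
  qed
qed

lemma loops_at_compose:
  assumes "continuous_on S f" "f ` S \<subseteq> T" "g \<in> loops_at S a"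
  shows "f \<circ> g \<in> loops_at T (f a)"
  using assms
  by (auto simp: loops_at_def path_image_compose pathstart_compose pathfinish_compose
           intro!: path_continuous_image intro: continuous_on_subset)

lemma induced_map_loop_class:
  assumes "continuous_on S f" "f ` S \<subseteq> T" "g \<in> loops_at S a"
  shows "induced_map T f a (loop_class S a g) = loop_class T (f a) (f \<circ> g)"
proof -
  have "congruent (homotopy_rel S a) (\<lambda>g. loop_class T (f a) (f \<circ> g))"
  proof (rule congruentI)
    fix g h assume "(g, h) \<in> homotopy_rel S a"
    then show "loop_class T (f a) (f \<circ> g) = loop_class T (f a) (f \<circ> h)"
      using assms(1,2)
      by (subst loop_class_eq_iff)
         (auto simp: homotopy_rel_def intro: loops_at_compose homotopic_paths_continuous_image)
  qed
  from UN_equiv_class[OF equiv_homotopy_rel this assms(3)]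
  show ?thesis by (simp add: induced_map_def)
qed

lemma induced_map_hom:
  assumes "continuous_on S f" "f ` S \<subseteq> T"
  shows "induced_map T f a \<in> hom (fundamental_group S a) (fundamental_group T (f a))"
  using assms
  by (auto simp: hom_def fundamental_group_carrier fundamental_group_mult induced_map_loop_class
                 loops_at_compose loops_at_join path_compose_join)


section \<open>The degree of a rational inner function\<close>

text \<open>
  The isomorphism of the integers onto the fundamental group of the circle at a point \<open>a\<close> of the
  circle that sends \<open>1\<close> to the class of the loop going once around counterclockwise.
\<close>
definition int_to_pi1_circle :: "complex \<Rightarrow> int \<Rightarrow> (real \<Rightarrow> complex) set" where
  "int_to_pi1_circle a n =
     loop_class (sphere 0 1) a (\<lambda>t. a * exp (2 * of_real pi * \<i> * of_real t))
       [^]\<^bsub>fundamental_group (sphere 0 1) a\<^esub> n"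

definition pi1_circle_to_int :: "complex \<Rightarrow> (real \<Rightarrow> complex) set \<Rightarrow> int" where
  "pi1_circle_to_int a = inv_into UNIV (int_to_pi1_circle a)"

text \<open>
  The identification of the fundamental group of the distinguished boundary at \<open>b\<close> with the
  integers, through the homotopy equivalence \<open>(x1, x2, x3) \<mapsto> x3\<close> onto the circle; its
  homotopy inverse is \<open>z \<mapsto> (0, 0, z)\<close>.
\<close>
definition pi1_dist_boundary_to_int ::
  "complex \<times> complex \<times> complex \<Rightarrow> (real \<Rightarrow> complex \<times> complex \<times> complex) set \<Rightarrow> int" where
  "pi1_dist_boundary_to_int b A = pi1_circle_to_int (comp3 b) (induced_map (sphere 0 1) comp3 b A)"

text \<open>
  The homomorphism of the integers that a map \<open>x\<close> of the circle into the distinguished boundary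
  induces on fundamental groups, based at \<open>1\<close> and at \<open>x 1\<close>. Both identifications with the integers
  are the counterclockwise ones, so the sign is determined. No absolute value is taken.
\<close>
definition tetra_pi1_hom :: "(complex \<Rightarrow> complex \<times> complex \<times> complex) \<Rightarrow> int \<Rightarrow> int" where
  "tetra_pi1_hom x n =
     pi1_dist_boundary_to_int (x 1)
       (induced_map tetrablock_dist_boundary x 1 (int_to_pi1_circle 1 n))"

definition tetra_degree :: "(complex \<Rightarrow> complex \<times> complex \<times> complex) \<Rightarrow> int" where
  "tetra_degree x = tetra_pi1_hom x 1"


section \<open>The degree of a finite Blaschke product\<close>

text \<open>Zeros are listed with multiplicity; unimodular constants are included, with \<open>A = {#}\<close>.\<close>
definition is_blaschke_product :: "complex \<Rightarrow> complex multiset \<Rightarrow> (complex \<Rightarrow> complex) \<Rightarrow> bool" where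
  "is_blaschke_product c A f \<longleftrightarrow>
     cmod c = 1 \<and> set_mset A \<subseteq> ball 0 1 \<and>
     (\<forall>z\<in>ball 0 1. f z = c * (\<Prod>a\<in>#A. (z - a) / (1 - cnj a * z)))"

definition blaschke_degree :: "(complex \<Rightarrow> complex) \<Rightarrow> nat" where
  "blaschke_degree f = (THE n. \<exists>c A. is_blaschke_product c A f \<and> size A = n)"

lemma is_blaschke_product_unique:
  assumes A: "is_blaschke_product c A f" and B: "is_blaschke_product d B f"
  shows "A = B"
proof -
  define P where "P A = (\<Prod>a\<in>#A. [:- a, 1:])" for A :: "complex multiset"
  define Q where "Q A = (\<Prod>a\<in>#A. [:1, - cnj a:])" for A :: "complex multiset"
  have polyP: "poly (P A) z = (\<Prod>a\<in>#A. z - a)" for A z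
    by (induction A) (auto simp: P_def algebra_simps)
  have polyQ: "poly (Q A) z = (\<Prod>a\<in>#A. 1 - cnj a * z)" for A z
    by (induction A) (auto simp: Q_def algebra_simps)
  have Q_nz: "poly (Q A) z \<noteq> 0" if "set_mset A \<subseteq> ball 0 1" "z \<in> ball 0 1" for A z
  proof
    assume "poly (Q A) z = 0"
    then obtain a where a: "a \<in># A" "cnj a * z = 1"
      by (auto simp: polyQ prod_mset_zero_iff)
    have "cmod a * cmod z < 1"
      using mult_strict_mono[of "cmod a" 1 "cmod z" 1] a(1) that by (auto simp: subset_iff)
    moreover have "cmod a * cmod z = 1"
      using arg_cong[OF a(2), of cmod] by (simp add: norm_mult)
    ultimately show False by simp
  qed
  have split: "(\<Prod>a\<in>#A. (z - a) / (1 - cnj a * z)) = poly (P A) z / poly (Q A) z" for A z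
    unfolding polyP polyQ by (induction A) auto
  have P_nz: "P A \<noteq> 0" and Qn: "Q A \<noteq> 0" for A
    by (auto simp: P_def Q_def prod_mset_zero_iff)
  have nz: "c \<noteq> 0" "d \<noteq> 0"
    using A B by (auto simp: is_blaschke_product_def)
  have "poly (smult c (P A * Q B)) z = poly (smult d (P B * Q A)) z" if z: "z \<in> ball 0 1" for z
  proof -
    have "c * (poly (P A) z / poly (Q A) z) = d * (poly (P B) z / poly (Q B) z)"
      using A B z by (auto simp: is_blaschke_product_def split)
    moreover have "poly (Q A) z \<noteq> 0" "poly (Q B) z \<noteq> 0"
      using A B z Q_nz by (simp_all add: is_blaschke_product_def)
    ultimately show ?thesis by (simp add: field_simps)
  qed
  then have "ball 0 1 \<subseteq> {z. poly (smult c (P A * Q B) - smult d (P B * Q A)) z = 0}"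
    by auto
  moreover have "infinite (ball (0::complex) 1)"
    using uncountable_ball[of 1 "0::complex"] countable_finite by auto
  ultimately have "smult c (P A * Q B) - smult d (P B * Q A) = 0"
    using poly_roots_finite finite_subset by blast
  then have eq: "smult c (P A * Q B) = smult d (P B * Q A)" by simp
  have order_P: "order z (P A) = count A z" for A z
  proof (induction A)
    case (add a A)
    have "order z (P (add_mset a A)) = order z ([:- a, 1:] * P A)"
      by (simp add: P_def)
    also have "\<dots> = order z [:- a, 1:] + order z (P A)"
      using P_nz[of "add_mset a A"] by (intro order_mult) (simp add: P_def)
    also have "order z [:- a, 1:] = (if z = a then 1 else 0)"
      using order_power_n_n[of a 1] by (auto intro: order_0I)
    finally show ?case using add by auto
  qed (simp add: P_def)
  have "count A z = count B z" for z
  proof (cases "z \<in> ball 0 1")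
    case True
    have "order z (Q A) = 0" "order z (Q B) = 0"
      using A B True Q_nz by (simp_all add: order_0I is_blaschke_product_def)
    then show ?thesis
      using arg_cong[OF eq, of "order z"] nz P_nz Qn
      by (simp add: order_smult order_mult order_P)
  next
    case False
    then have "z \<notin># A" "z \<notin># B"
      using A B by (auto simp: is_blaschke_product_def)
    then show ?thesis by (simp add: not_in_iff)
  qed
  then show ?thesis by (simp add: multiset_eq_iff)
qed

lemma blaschke_degree_eq: "is_blaschke_product c A f \<Longrightarrow> blaschke_degree f = size A"
  unfolding blaschke_degree_def by (rule the_equality) (auto dest: is_blaschke_product_unique)

end

theory Submission
  imports Defs "HOL-Algebra.Elementary_Groups"
begin

text \<open>
  The isomorphism of the fundamental group of the distinguished boundary with the integers is
  defined through the projection \<open>x \<mapsto> x3\<close> onto the circle. So \<open>tetra_degree x\<close> is the integer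
  belonging to the class of the loop \<open>t \<mapsto> x3 (exp (2 \<pi> i t))\<close> on the circle.
  For loops on the circle that integer is the winding number about \<open>0\<close>: two such loops with the
  same base point are homotopic exactly when their winding numbers agree, and the winding number
  is additive under concatenation (\<open>int_to_pi1_circle_eq\<close>, \<open>pi1_circle_to_int_loop_class\<close>).

  It remains to compute the winding number of \<open>x3\<close> along the circle. A rational function that
  is analytic in the disc and unimodular on the circle is a finite Blaschke product, by the maximum
  modulus principle applied after dividing out its zeros (\<open>rational_unimodular_imp_blaschke\<close>).
  Contracting the zeros of a Blaschke product of degree \<open>n\<close> to the origin, along \<open>s a\<close> with
  \<open>0 \<le> s \<le> 1\<close>, deforms it on the circle to \<open>c z ^ n\<close> through maps without zeros there, so its
  winding number is \<open>n\<close> (\<open>winding_number_blaschke_loop\<close>).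

  The induced map on fundamental groups is only meaningful if \<open>x\<close> is continuous on the circle. This
  follows because all three components have modulus at most \<open>1\<close> on the distinguished boundary, which
  rules out poles on the circle (\<open>bounded_on_circle_imp_no_pole\<close>).
\<close>


section \<open>Winding numbers and the fundamental group of the circle\<close>

text \<open>
  In the punctured plane, the winding number about \<open>0\<close> classifies paths with common end points.
  The retraction \<open>sgn\<close> of the punctured plane onto the circle carries a homotopy there to a
  homotopy in the circle and fixes paths that already lie in the circle.
\<close>
lemma homotopic_paths_circle_iff_winding_number:
  assumes "path g" "path_image g \<subseteq> sphere 0 1" "path h" "path_image h \<subseteq> sphere 0 1"
    and "pathstart g = pathstart h" "pathfinish g = pathfinish h"
  shows "homotopic_paths (sphere 0 1) g h \<longleftrightarrow> winding_number g 0 = winding_number h 0"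
proof -
  have sub: "sphere 0 1 \<subseteq> - {0::complex}" by auto
  have eq: "winding_number g 0 = winding_number h 0 \<longleftrightarrow> homotopic_paths (-{0}) g h"
    using assms sub by (intro winding_number_homotopic_paths_eq) auto
  have "homotopic_paths (sphere 0 1) g h" if "homotopic_paths (-{0}) g h"
  proof -
    have retract: "homotopic_paths (sphere 0 1) (sgn \<circ> g) (sgn \<circ> h)"
      using that
      by (rule homotopic_paths_continuous_image) (auto intro!: continuous_intros simp: norm_sgn)
    have fixed: "homotopic_paths (sphere 0 1) k (sgn \<circ> k)"
      if "path k" "path_image k \<subseteq> sphere 0 1" for k :: "real \<Rightarrow> complex"
    proof (rule homotopic_paths_eq[OF that])
      fix t :: real assume "t \<in> {0..1}"
      then have "k t \<in> sphere 0 1" using that(2) unfolding path_image_def by blast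
      then have "norm (k t) = 1" by simp
      then show "k t = (sgn \<circ> k) t" by (simp add: sgn_div_norm)
    qed
    show ?thesis
      using fixed[OF assms(1,2)] retract fixed[OF assms(3,4)]
      by (meson homotopic_paths_sym homotopic_paths_trans)
  qed
  then show ?thesis
    using eq homotopic_paths_subset[OF _ sub] by blast
qed

lemma loop_class_circle_eq_iff_winding_number:
  assumes "g \<in> loops_at (sphere 0 1) a" "h \<in> loops_at (sphere 0 1) a"
  shows "loop_class (sphere 0 1) a g = loop_class (sphere 0 1) a h \<longleftrightarrow>
    winding_number g 0 = winding_number h 0"
proof -
  have "homotopic_paths (sphere 0 1) g h \<longleftrightarrow> winding_number g 0 = winding_number h 0"
    using assms by (intro homotopic_paths_circle_iff_winding_number) (auto simp: loops_at_def)
  then show ?thesis using loop_class_eq_iff[OF assms] by simp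
qed

definition circle_loop :: "complex \<Rightarrow> int \<Rightarrow> real \<Rightarrow> complex" where
  "circle_loop a n t = a * exp (of_int n * (2 * of_real pi * \<i> * of_real t))"

lemma circle_loop_in_loops_at:
  assumes "cmod a = 1"
  shows "circle_loop a n \<in> loops_at (sphere 0 1) a"
proof -
  have "path (circle_loop a n)"
    unfolding path_def circle_loop_def by (intro continuous_intros)
  moreover have "path_image (circle_loop a n) \<subseteq> sphere 0 1"
    using assms by (auto simp: path_image_def circle_loop_def norm_mult norm_exp_eq_Re)
  moreover have "exp (of_int n * (2 * of_real pi * \<i>)) = 1"
    using exp_integer_2pi[of "of_int n"] by (simp add: mult_ac)
  ultimately show ?thesis
    by (simp add: loops_at_def pathstart_def pathfinish_def circle_loop_def)
qed

text \<open>The loop lifts under \<open>exp\<close> to a straight path that climbs by \<open>2 \<pi> i n\<close>.\<close>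
lemma winding_number_circle_loop:
  assumes "a \<noteq> 0"
  shows "winding_number (circle_loop a n) 0 = of_int n"
proof -
  define p where "p t = Ln a + of_int n * (2 * of_real pi * \<i> * of_real t)" for t :: real
  have "path p" unfolding path_def p_def by (intro continuous_intros)
  moreover have "circle_loop a n = exp \<circ> p"
    using assms by (auto simp: circle_loop_def p_def exp_add)
  ultimately show ?thesis
    by (simp add: winding_number_compose_exp) (simp add: p_def pathstart_def pathfinish_def)
qed

text \<open>
  Powers in the fundamental group need not be unravelled: by additivity of the winding number,
  \<open>n \<mapsto> [circle_loop a n]\<close> is a homomorphism from the integers, and such a homomorphism is
  determined by its value at \<open>1\<close>.
\<close>
lemma int_to_pi1_circle_eq:
  assumes "cmod a = 1"
  shows "int_to_pi1_circle a n = loop_class (sphere 0 1) a (circle_loop a n)"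
proof -
  let ?G = "fundamental_group (sphere 0 1) a"
  define h where "h m = loop_class (sphere 0 1) a (circle_loop a m)" for m
  note L = circle_loop_in_loops_at[OF assms]
  have a: "a \<noteq> 0" using assms by auto
  have "circle_loop a m +++ circle_loop a k \<in> loops_at (sphere 0 1) a" for m k
    by (intro loops_at_join L)
  moreover have "winding_number (circle_loop a m +++ circle_loop a k) 0 =
      winding_number (circle_loop a (m + k)) 0" for m k
  proof -
    have "winding_number (circle_loop a m +++ circle_loop a k) 0 =
        winding_number (circle_loop a m) 0 + winding_number (circle_loop a k) 0"
      using L[of m] L[of k] by (intro winding_number_join) (auto simp: loops_at_def)
    then show ?thesis using a by (simp add: winding_number_circle_loop)
  qed
  ultimately have "h (m + k) = h m \<otimes>\<^bsub>?G\<^esub> h k" for m k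
    unfolding h_def using L by (simp add: fundamental_group_mult loop_class_circle_eq_iff_winding_number)
  then have hom: "h \<in> hom integer_group ?G"
    using L by (auto simp: hom_def h_def fundamental_group_carrier)
  have "group ?G" using assms by (intro group_fundamental_group) simp
  then interpret group_hom integer_group ?G h
    using hom by (simp add: group_hom_def group_hom_axioms_def)
  have "h (1 [^]\<^bsub>integer_group\<^esub> n) = h 1 [^]\<^bsub>?G\<^esub> n"
    by (rule hom_int_pow) simp
  then show ?thesis
    by (simp add: h_def int_to_pi1_circle_def circle_loop_def[abs_def])
qed

lemma pi1_circle_to_int_loop_class:
  assumes "g \<in> loops_at (sphere 0 1) a" "winding_number g 0 = of_int n"
  shows "pi1_circle_to_int a (loop_class (sphere 0 1) a g) = n"
proof -
  have "a \<in> path_image g" using assms(1) pathstart_in_path_image[of g] by (auto simp: loops_at_def)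
  then have a: "cmod a = 1" using assms(1) by (auto simp: loops_at_def)
  then have a0: "a \<noteq> 0" by auto
  note L = circle_loop_in_loops_at[OF a]
  have "inj (int_to_pi1_circle a)"
    by (rule injI) (use L a0 in \<open>simp add: int_to_pi1_circle_eq[OF a]
        loop_class_circle_eq_iff_winding_number winding_number_circle_loop\<close>)
  moreover have "loop_class (sphere 0 1) a g = int_to_pi1_circle a n"
    using assms L a0
    by (simp add: int_to_pi1_circle_eq[OF a] loop_class_circle_eq_iff_winding_number
        winding_number_circle_loop)
  ultimately show ?thesis by (simp add: pi1_circle_to_int_def)
qed


section \<open>The winding number of a Blaschke product\<close>

text \<open>
  Replacing every zero \<open>a\<close> by \<open>s a\<close> keeps the zeros inside the disc for \<open>0 \<le> s \<le> 1\<close>, so numerators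
  and denominators stay away from \<open>0\<close> on the circle. At \<open>s = 0\<close> each factor is just \<open>z\<close>. The
  homotopy moves the base point of the loop, hence it is one of free loops.
\<close>
lemma winding_number_blaschke_loop:
  assumes c: "cmod c = 1" and A: "set_mset A \<subseteq> ball 0 1"
  shows "winding_number (\<lambda>t. c * (\<Prod>a\<in>#A. (circle_loop 1 1 t - a) / (1 - cnj a * circle_loop 1 1 t))) 0
    = of_nat (size A)"
proof -
  let ?e = "circle_loop 1 1"
  define H where "H z = c * (\<Prod>a\<in>#A.
      (?e (snd z) - of_real (fst z) * a) / (1 - of_real (fst z) * cnj a * ?e (snd z)))"
    for z :: "real \<times> real"
  have e: "cmod (?e t) = 1" for t by (simp add: circle_loop_def norm_exp_eq_Re)
  have e01: "?e 0 = 1" "?e 1 = 1"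
    using circle_loop_in_loops_at[of 1 1] by (auto simp: loops_at_def pathstart_def pathfinish_def)
  have sa: "cmod (of_real s * a) < 1" if "s \<in> {0..1}" "a \<in># A" for s a
  proof -
    have "cmod a < 1" using that(2) A by auto
    moreover have "\<bar>s\<bar> * cmod a \<le> 1 * cmod a"
      using that(1) by (intro mult_right_mono) auto
    ultimately show ?thesis by (simp add: norm_mult)
  qed
  have num: "?e t - of_real s * a \<noteq> 0" and den: "1 - of_real s * cnj a * ?e t \<noteq> 0"
    if "s \<in> {0..1}" "a \<in># A" for s t a
  proof -
    show "?e t - of_real s * a \<noteq> 0"
      using sa[OF that] e[of t] by auto
    have "cmod (of_real s * cnj a * ?e t) < 1"
      using sa[OF that] e[of t] by (simp add: norm_mult)
    then show "1 - of_real s * cnj a * ?e t \<noteq> 0" by auto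
  qed
  have cont: "continuous_on ({0..1} \<times> {0..1}) H"
  proof -
    have "continuous_on ({0..1} \<times> {0..1})
        (\<lambda>z. \<Prod>a\<in>#B. (?e (snd z) - of_real (fst z) * a) / (1 - of_real (fst z) * cnj a * ?e (snd z)))"
      if "set_mset B \<subseteq> set_mset A" for B
      using that
    proof (induction B)
      case (add a B)
      then have aA: "a \<in># A" by simp
      have ce: "continuous_on S (\<lambda>z. ?e (snd z))" for S :: "(real \<times> real) set"
        unfolding circle_loop_def by (intro continuous_intros)
      have "continuous_on ({0..1} \<times> {0..1})
          (\<lambda>z. (?e (snd z) - of_real (fst z) * a) / (1 - of_real (fst z) * cnj a * ?e (snd z)))"
        using den[OF _ aA] by (intro continuous_intros ce) auto
      moreover have "continuous_on ({0..1} \<times> {0..1})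
          (\<lambda>z. \<Prod>a\<in>#B. (?e (snd z) - of_real (fst z) * a) / (1 - of_real (fst z) * cnj a * ?e (snd z)))"
        using add by simp
      ultimately show ?case
        unfolding image_mset_add_mset prod_mset.add_mset by (rule continuous_on_mult)
    qed simp
    from continuous_on_mult_left[OF this[OF subset_refl]] show ?thesis unfolding H_def .
  qed
  have "homotopic_loops (-{0}) (\<lambda>t. H (0, t)) (\<lambda>t. H (1, t))"
    unfolding homotopic_loops
  proof (intro exI[of _ H] conjI ballI)
    show "continuous_on ({0..1} \<times> {0..1}) H" by (rule cont)
    show "H \<in> {0..1} \<times> {0..1} \<rightarrow> - {0}"
      using c num den by (auto simp: H_def prod_mset_zero_iff)
  qed (auto simp: H_def pathstart_def pathfinish_def e01)
  then have "winding_number (\<lambda>t. H (1, t)) 0 = winding_number (\<lambda>t. H (0, t)) 0"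
    by (rule winding_number_homotopic_loops[symmetric])
  also have "(\<lambda>t. H (0, t)) = circle_loop c (int (size A))"
    by (auto simp: H_def circle_loop_def exp_of_nat_mult)
  also have "winding_number \<dots> 0 = of_nat (size A)"
    using c by (subst winding_number_circle_loop) auto
  finally show ?thesis by (simp add: H_def)
qed


section \<open>Rational functions on the circle\<close>

text \<open>
  At a zero of \<open>q\<close> the quotient has the default value \<open>0\<close>, so the contradiction must come from
  nearby points. Since \<open>q\<close> has finitely many zeros, the inequality \<open>\<bar>p\<bar> \<le> B \<bar>q\<bar>\<close>
  holds at all other points of the circle near by and passes to the limit: a zero of \<open>q\<close> on the circle would
  be a zero of \<open>p\<close>.
\<close>
lemma bounded_on_circle_imp_no_pole:
  fixes p q :: "complex poly"
  assumes "coprime p q" "q \<noteq> 0"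
    and bound: "\<And>z. z \<in> sphere 0 1 \<Longrightarrow> cmod (poly p z / poly q z) \<le> B"
    and z: "z \<in> sphere 0 1"
  shows "poly q z \<noteq> 0"
proof
  assume q0: "poly q z = 0"
  let ?F = "at z within sphere 0 1"
  have "z islimpt sphere 0 1"
  proof (rule connected_imp_perfect[OF _ z])
    show "connected (sphere (0::complex) 1)" by (simp add: connected_sphere)
    show "sphere 0 1 \<noteq> {x}" for x :: complex
    proof -
      have "1 \<in> sphere (0::complex) 1" "-1 \<in> sphere (0::complex) 1" by auto
      moreover have "\<not> (1 = x \<and> -1 = x)" by auto
      ultimately show ?thesis by blast
    qed
  qed
  then have F: "?F \<noteq> bot" by (simp add: trivial_limit_within)
  have "\<not> z islimpt {w. poly q w = 0}"
    by (intro islimpt_finite poly_roots_finite \<open>q \<noteq> 0\<close>)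
  then have "\<forall>\<^sub>F w in at z. w \<notin> {w. poly q w = 0}"
    by (simp only: islimpt_iff_eventually not_not)
  then have "\<forall>\<^sub>F w in ?F. w \<notin> {w. poly q w = 0}"
    by (rule filter_leD[OF at_le[OF subset_UNIV]])
  moreover have "\<forall>\<^sub>F w in ?F. w \<in> sphere 0 1"
    by (simp add: eventually_at_filter)
  ultimately have "\<forall>\<^sub>F w in ?F. cmod (poly p w) \<le> B * cmod (poly q w)"
  proof eventually_elim
    case (elim w)
    then show ?case using bound[of w] by (simp add: norm_divide field_simps)
  qed
  moreover have "((\<lambda>w. cmod (poly p w)) \<longlongrightarrow> cmod (poly p z)) ?F"
    "((\<lambda>w. B * cmod (poly q w)) \<longlongrightarrow> B * cmod (poly q z)) ?F"
    by (intro tendsto_intros)+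
  ultimately have "cmod (poly p z) \<le> B * cmod (poly q z)"
    using tendsto_le[OF F] by blast
  then have "poly p z = 0" using q0 by simp
  then show False
    using q0 assms(1) coprime_poly_0 by blast
qed

lemma poly_factor_roots_in:
  fixes p :: "complex poly"
  assumes "p \<noteq> 0"
  obtains A r where "p = (\<Prod>a\<in>#A. [:- a, 1:]) * r" "set_mset A \<subseteq> S" "\<And>z. z \<in> S \<Longrightarrow> poly r z \<noteq> 0"
  using assms
proof (induction "degree p" arbitrary: p thesis rule: less_induct)
  case less
  show ?case
  proof (cases "\<exists>a\<in>S. poly p a = 0")
    case True
    then obtain a p' where a: "a \<in> S" and p': "p = [:- a, 1:] * p'"
      by (auto simp: poly_eq_0_iff_dvd elim: dvdE)
    with \<open>p \<noteq> 0\<close> have "p' \<noteq> 0" by auto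
    then have "degree p' < degree p" unfolding p' by (subst degree_mult_eq) auto
    then obtain A r
      where "p' = (\<Prod>a\<in>#A. [:- a, 1:]) * r" "set_mset A \<subseteq> S" "\<And>z. z \<in> S \<Longrightarrow> poly r z \<noteq> 0"
      by (rule less.hyps[OF _ _ \<open>p' \<noteq> 0\<close>]) blast
    then show ?thesis
      using a by (intro less.prems(1)[of "add_mset a A" r]) (auto simp: p' mult_ac)
  next
    case False
    then show ?thesis by (intro less.prems(1)[of "{#}" p]) auto
  qed
qed

text \<open>The maximum modulus principle applies both to \<open>g\<close> and to \<open>1 / g\<close>.\<close>
lemma unimodular_on_circle_imp_constant:
  assumes hol: "g holomorphic_on ball 0 1" and cont: "continuous_on (cball 0 1) g"
    and circle: "\<And>z. z \<in> sphere 0 1 \<Longrightarrow> cmod (g z) = 1"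
    and nz: "\<And>z. z \<in> ball 0 1 \<Longrightarrow> g z \<noteq> 0"
  obtains c where "cmod c = 1" "\<And>z. z \<in> cball 0 1 \<Longrightarrow> g z = c"
proof -
  have nz': "g z \<noteq> 0" if "z \<in> cball 0 1" for z
    using that nz[of z] circle[of z] by (cases "cmod z = 1") auto
  have le: "cmod (g z) \<le> 1" if "z \<in> ball 0 1" for z
    by (rule maximum_modulus_frontier[OF _ _ bounded_ball _ that])
       (simp_all add: interior_open hol cont circle)
  have inv_le: "cmod (inverse (g z)) \<le> 1" if "z \<in> ball 0 1" for z
  proof (rule maximum_modulus_frontier[OF _ _ bounded_ball _ that])
    show "(\<lambda>z. inverse (g z)) holomorphic_on interior (ball 0 1)"
      using holomorphic_on_inverse[OF hol nz] by (simp add: interior_open)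
    show "continuous_on (closure (ball 0 1)) (\<lambda>z. inverse (g z))"
      using nz' by (auto intro!: continuous_on_inverse cont)
    show "cmod (inverse (g z)) \<le> 1" if "z \<in> frontier (ball 0 1)" for z
      using circle[of z] that by (simp add: norm_inverse)
  qed
  have norm1: "cmod (g z) = 1" if "z \<in> ball 0 1" for z
    using le[OF that] inv_le[OF that] nz[OF that] by (simp add: norm_inverse inverse_le_1_iff)
  have "g constant_on ball 0 1"
    by (rule maximum_modulus_principle[OF hol, of "ball 0 1" 0]) (auto simp: norm1)
  then obtain c where c: "\<And>z. z \<in> ball 0 1 \<Longrightarrow> g z = c" by (auto simp: constant_on_def)
  show thesis
  proof
    show "cmod c = 1" using c[of 0] norm1[of 0] by simp
    show "g z = c" if "z \<in> cball 0 1" for z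
      using that cont by (intro continuous_constant_on_closure[of "ball 0 1" g c z]) (auto simp: c)
  qed
qed

text \<open>
  Let \<open>P / Q\<close> be the Blaschke product formed with the zeros of \<open>p\<close> in the disc. It is unimodular on
  the circle, as is \<open>p / q\<close>. Hence their quotient \<open>g\<close> is unimodular on the circle and has neither
  zeros nor poles in the disc, so it is constant.
\<close>
lemma rational_unimodular_imp_blaschke:
  fixes p q :: "complex poly"
  assumes q: "\<And>z. z \<in> cball 0 1 \<Longrightarrow> poly q z \<noteq> 0"
    and circle: "\<And>z. z \<in> sphere 0 1 \<Longrightarrow> cmod (poly p z / poly q z) = 1"
  obtains c A where "cmod c = 1" "set_mset A \<subseteq> ball 0 1"
    "\<And>z. z \<in> cball 0 1 \<Longrightarrow> poly p z / poly q z = c * (\<Prod>a\<in>#A. (z - a) / (1 - cnj a * z))"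
proof -
  have "p \<noteq> 0" using circle[of 1] by auto
  then obtain A r where pA: "p = (\<Prod>a\<in>#A. [:- a, 1:]) * r"
    and A: "set_mset A \<subseteq> ball 0 1" and r: "\<And>z. z \<in> ball 0 1 \<Longrightarrow> poly r z \<noteq> 0"
    by (rule poly_factor_roots_in[where S = "ball 0 1"]) blast
  define P where "P = (\<Prod>a\<in>#A. [:- a, 1:])"
  define Q where "Q = (\<Prod>a\<in>#A. [:1, - cnj a:])"
  have P: "poly P z = (\<Prod>a\<in>#A. z - a)" for z
    unfolding P_def by (induction A) (auto simp: algebra_simps)
  have Q: "poly Q z = (\<Prod>a\<in>#A. 1 - cnj a * z)" for z
    unfolding Q_def by (induction A) (auto simp: algebra_simps)
  have split: "(\<Prod>a\<in>#A. (z - a) / (1 - cnj a * z)) = poly P z / poly Q z" for z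
    unfolding P Q by (induction A) auto
  have Q_nz: "poly Q z \<noteq> 0" if z: "z \<in> cball 0 1" for z
  proof
    assume "poly Q z = 0"
    then obtain a where a: "a \<in># A" "cnj a * z = 1" by (auto simp: Q prod_mset_zero_iff)
    have "cmod a * cmod z \<le> cmod a * 1" using z by (intro mult_left_mono) auto
    moreover have "cmod a < 1" using a(1) A by auto
    moreover have "cmod a * cmod z = 1" using arg_cong[OF a(2), of cmod] by (simp add: norm_mult)
    ultimately show False by simp
  qed
  have PQ: "cmod (poly P z) = cmod (poly Q z)" if z: "z \<in> sphere 0 1" for z
  proof -
    have "cmod (z - a) = cmod (1 - cnj a * z)" for a
    proof -
      \<comment> \<open>On the circle, \<open>cnj z\<close> is the inverse of \<open>z\<close>.\<close>
      have "z * cnj z = 1" using z by (simp add: complex_norm_square[symmetric])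
      then have "1 - cnj a * z = z * cnj (z - a)" by (simp add: algebra_simps)
      then have "cmod (1 - cnj a * z) = cmod z * cmod (cnj (z - a))" by (simp only: norm_mult)
      then show ?thesis using z by (simp only: complex_mod_cnj) simp
    qed
    then show ?thesis unfolding P Q by (induction A) (auto simp: norm_mult)
  qed
  define g where "g z = poly r z * poly Q z / poly q z" for z
  obtain c where c: "cmod c = 1" "\<And>z. z \<in> cball 0 1 \<Longrightarrow> g z = c"
  proof (rule unimodular_on_circle_imp_constant[of g])
    show "g holomorphic_on ball 0 1" unfolding g_def
      by (intro holomorphic_intros) (use q in auto)
    show "continuous_on (cball 0 1) g" unfolding g_def
      by (intro continuous_intros) (use q in auto)
    show "cmod (g z) = 1" if "z \<in> sphere 0 1" for z
      using circle[OF that] PQ[OF that] Q_nz[of z] that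
      by (auto simp: g_def pA norm_mult norm_divide mult_ac simp flip: P_def)
    show "g z \<noteq> 0" if "z \<in> ball 0 1" for z
      using that r q Q_nz by (simp add: g_def)
  qed (rule that)
  show thesis
  proof (rule that[OF c(1) A])
    fix z :: complex assume z: "z \<in> cball 0 1"
    have "poly r z / poly q z = c / poly Q z"
      using c(2)[OF z] Q_nz[OF z] q[OF z] by (simp add: g_def field_simps)
    then have "poly P z * (poly r z / poly q z) = poly P z * (c / poly Q z)" by simp
    then show "poly p z / poly q z = c * (\<Prod>a\<in>#A. (z - a) / (1 - cnj a * z))"
      unfolding split pA P_def[symmetric] by simp
  qed
qed

lemma rational_analytic_on_disc_no_pole:
  assumes "rational_analytic_on_disc f" "\<And>z. z \<in> sphere 0 1 \<Longrightarrow> cmod (f z) \<le> B"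
  obtains p q where "\<And>z. z \<in> cball 0 1 \<Longrightarrow> poly q z \<noteq> 0" "\<And>z. z \<in> cball 0 1 \<Longrightarrow> f z = poly p z / poly q z"
proof -
  obtain p q where pq: "coprime p q" "\<And>z. z \<in> ball 0 1 \<Longrightarrow> poly q z \<noteq> 0"
    "\<And>z. z \<in> cball 0 1 \<Longrightarrow> f z = poly p z / poly q z"
    using assms(1) unfolding rational_analytic_on_disc_def by blast
  have "q \<noteq> 0" using pq(2)[of 0] by auto
  then have "poly q z \<noteq> 0" if "z \<in> sphere 0 1" for z
    using bounded_on_circle_imp_no_pole[OF pq(1), of B z] assms(2) pq(3) that by simp
  then have "poly q z \<noteq> 0" if "z \<in> cball 0 1" for z
    using that pq(2)[of z] by (cases "cmod z = 1") auto
  then show thesis using pq(3) by (rule that)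
qed

lemma rational_bounded_on_circle_imp_continuous:
  assumes "rational_analytic_on_disc f" "\<And>z. z \<in> sphere 0 1 \<Longrightarrow> cmod (f z) \<le> B"
  shows "continuous_on (cball 0 1) f"
proof -
  obtain q p where q: "\<And>z. z \<in> cball 0 1 \<Longrightarrow> poly q z \<noteq> 0"
    and f: "\<And>z. z \<in> cball 0 1 \<Longrightarrow> f z = poly p z / poly q z"
    by (rule rational_analytic_on_disc_no_pole[OF assms]) blast+
  have "continuous_on (cball 0 1) (\<lambda>z. poly p z / poly q z)"
    by (intro continuous_intros) (use q in auto)
  then show ?thesis by (rule continuous_on_eq) (simp add: f)
qed


section \<open>The degree as a winding number\<close>

text \<open>
  The class of the standard generator is carried by \<open>x\<close>, and then by the projection to the third
  component, to the class of the composite loop, whose integer is its winding number.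
\<close>
lemma tetra_degree_eq_winding_number:
  assumes cont: "continuous_on (sphere 0 1) x"
    and maps: "x ` sphere 0 1 \<subseteq> tetrablock_dist_boundary"
    and wind: "winding_number (\<lambda>t. comp3 (x (circle_loop 1 1 t))) 0 = of_int n"
  shows "tetra_degree x = n"
proof -
  let ?T = "tetrablock_dist_boundary" and ?e = "circle_loop 1 1"
  have e: "?e \<in> loops_at (sphere 0 1) 1" by (rule circle_loop_in_loops_at) simp
  have cont3: "continuous_on ?T comp3" by (intro continuous_intros)
  have maps3: "comp3 ` ?T \<subseteq> sphere 0 1" by (auto simp: tetrablock_dist_boundary_def)
  have xe: "x \<circ> ?e \<in> loops_at ?T (x 1)" by (rule loops_at_compose[OF cont maps e])
  have "comp3 \<circ> (x \<circ> ?e) \<in> loops_at (sphere 0 1) (comp3 (x 1))"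
    by (rule loops_at_compose[OF cont3 maps3 xe])
  then have "pi1_circle_to_int (comp3 (x 1)) (loop_class (sphere 0 1) (comp3 (x 1)) (comp3 \<circ> (x \<circ> ?e))) = n"
    using wind by (intro pi1_circle_to_int_loop_class) (simp_all add: o_def)
  then show ?thesis
    by (simp add: tetra_degree_def tetra_pi1_hom_def pi1_dist_boundary_to_int_def int_to_pi1_circle_eq
        induced_map_loop_class[OF cont maps e] induced_map_loop_class[OF cont3 maps3 xe])
qed

theorem proposition4p14:
  fixes x :: "complex \<Rightarrow> complex \<times> complex \<times> complex"
  assumes "rational_tetra_inner x"
  shows "tetra_degree x = int (blaschke_degree (\<lambda>z. comp3 (x z)))"
proof -
  have rat: "rational_analytic_on_disc (\<lambda>z. comp1 (x z))" "rational_analytic_on_disc (\<lambda>z. comp2 (x z))"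
    "rational_analytic_on_disc (\<lambda>z. comp3 (x z))"
    and maps: "\<And>z. z \<in> sphere 0 1 \<Longrightarrow> x z \<in> tetrablock_dist_boundary"
    using assms by (auto simp: rational_tetra_inner_def)
  have circle: "cmod (comp1 (x z)) \<le> 1" "cmod (comp2 (x z)) \<le> 1" "cmod (comp3 (x z)) = 1"
    if "z \<in> sphere 0 1" for z
    using maps[OF that] by (auto simp: tetrablock_dist_boundary_def norm_mult)
  have "continuous_on (cball 0 1) (\<lambda>z. (comp1 (x z), comp2 (x z), comp3 (x z)))"
    using circle by (intro continuous_on_Pair rational_bounded_on_circle_imp_continuous[OF rat(1)]
        rational_bounded_on_circle_imp_continuous[OF rat(2)]
        rational_bounded_on_circle_imp_continuous[OF rat(3)]) auto
  then have cont: "continuous_on (sphere 0 1) x"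
    by (auto intro: continuous_on_subset)
  obtain q p where q: "\<And>z. z \<in> cball 0 1 \<Longrightarrow> poly q z \<noteq> 0"
    and x3: "\<And>z. z \<in> cball 0 1 \<Longrightarrow> comp3 (x z) = poly p z / poly q z"
    by (rule rational_analytic_on_disc_no_pole[OF rat(3)]) (use circle(3) in auto)
  have unimodular: "cmod (poly p z / poly q z) = 1" if "z \<in> sphere 0 1" for z
    using circle(3)[OF that] x3[of z] that by simp
  obtain c A where cA: "cmod c = 1" "set_mset A \<subseteq> ball 0 1"
    and "\<And>z. z \<in> cball 0 1 \<Longrightarrow> poly p z / poly q z = c * (\<Prod>a\<in>#A. (z - a) / (1 - cnj a * z))"
    by (rule rational_unimodular_imp_blaschke[OF q unimodular]) blast+
  then have blaschke: "comp3 (x z) = c * (\<Prod>a\<in>#A. (z - a) / (1 - cnj a * z))" if "z \<in> cball 0 1" for z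
    using x3 that by simp
  have "is_blaschke_product c A (\<lambda>z. comp3 (x z))"
    using cA blaschke by (simp add: is_blaschke_product_def)
  then have deg: "blaschke_degree (\<lambda>z. comp3 (x z)) = size A" by (rule blaschke_degree_eq)
  have "circle_loop 1 1 t \<in> cball 0 1" for t by (simp add: circle_loop_def norm_exp_eq_Re)
  then have "winding_number (\<lambda>t. comp3 (x (circle_loop 1 1 t))) 0 = of_int (int (size A))"
    using winding_number_blaschke_loop[OF cA] by (simp add: blaschke)
  then have "tetra_degree x = int (size A)"
    using cont maps by (intro tetra_degree_eq_winding_number) auto
  then show ?thesis by (simp add: deg)
qed

end
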